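(* Let $n<d$, $\mathbf X\in\mathbb R^{n\times d}$ with $\mathbf X\mathbf X^\top$ non-singular, $\theta_S,\theta_T\in\mathbb R^d$ and $\mathbf y=\mathbf X\theta_T$. Consider a depth-$L$ linear network whose weights before pretraining are 0-balanced and which is pretrained by gradient flow to perfection, so that its end-to-end vector at the start of fine-tuning ($t=0$) is $\beta(0)=\theta_S$; assume also that gradient-flow fine-tuning of all layers from these weights on $\frac1n\|\mathbf X\beta-\mathbf y\|^2$ would have training loss converging to $0$. Let $1\le k\le L$. If the first $k$ layers are frozen during fine-tuning, i.e. $\mathbf W_i(t)=\mathbf W_i(0)$ for all $t\ge0$ and $1\le i\le k$, and only the remaining layers are trained, then the fine-tuned model satisfies, for every $t\ge0$, $$\langle\beta(t),\mathbf x\rangle=c\,\langle\mathbf x,\theta_S\rangle\qquad\text{for all }\mathbf x\in\mathbb R^d,$$ for some scalar $c$ (which may depend on $t$ but not on $\mathbf x$).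
   Context: A depth-$L$ linear network has weights $\mathbf W_j\in\mathbb R^{d_{j-1}\times d_j}$, $j=1,\dots,L$, with $d_0=d$, $d_L=1$, $d_j\ge d$ for $1\le j\le L-1$, and end-to-end vector $\beta(t)=\mathbf W_1(t)\cdots\mathbf W_L(t)$, computing $\mathbf x\mapsto\mathbf x^\top\beta(t)$. The weights are 0-balanced if $\mathbf W_j^\top\mathbf W_j=\mathbf W_{j+1}\mathbf W_{j+1}^\top$ for $j=1,\dots,L-1$. Gradient flow on a loss $\ell$ means $\dot{\mathbf W}_j=-\partial\ell/\partial\mathbf W_j$ for all trained layers $j$. Pretraining is gradient flow (all layers) on $\frac1{n_S}\|\mathbf X_S\beta-\mathbf X_S\theta_S\|^2$ for some $\mathbf X_S\in\mathbb R^{n_S\times d}$. *)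

theory Defs
  imports "HOL-Analysis.Analysis" "Jordan_Normal_Form.Matrix"
begin

text \<open>A network is a family of layers \<open>W 1, \<dots>, W L\<close>, where \<open>W j\<close> has size
  \<open>dims (j - 1) \<times> dims j\<close>; the value of \<open>W\<close> at other indices is irrelevant. The layer widths vary
  with \<open>j\<close>, so we use matrices with explicit carriers; limits and time derivatives are taken
  entrywise.\<close>

type_synonym weights = "nat \<Rightarrow> real mat"

definition admissible_dims :: "nat \<Rightarrow> nat \<Rightarrow> (nat \<Rightarrow> nat) \<Rightarrow> bool" where
  "admissible_dims d L dims \<longleftrightarrow>
     dims 0 = d \<and> dims L = 1 \<and> (\<forall>j. 1 \<le> j \<and> j \<le> L - 1 \<longrightarrow> d \<le> dims j)"

definition is_weights :: "nat \<Rightarrow> (nat \<Rightarrow> nat) \<Rightarrow> weights \<Rightarrow> bool" where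
  "is_weights L dims W \<longleftrightarrow> (\<forall>j\<in>{1..L}. W j \<in> carrier_mat (dims (j - 1)) (dims j))"

text \<open>\<open>W 1 * (W 2 * (\<dots> * (W L * 1)))\<close>; the last factor is the \<open>1 \<times> 1\<close> identity because
  the output dimension \<open>dims L\<close> is 1. The product is a single column, read as a vector.\<close>

definition end_to_end :: "nat \<Rightarrow> weights \<Rightarrow> real vec" where
  "end_to_end L W = col (foldr (\<lambda>j M. W j * M) [1..<Suc L] (1\<^sub>m 1)) 0"

definition zero_balanced :: "nat \<Rightarrow> weights \<Rightarrow> bool" where
  "zero_balanced L W \<longleftrightarrow>
     (\<forall>j. 1 \<le> j \<and> j \<le> L - 1 \<longrightarrow>
        transpose_mat (W j) * W j = W (Suc j) * transpose_mat (W (Suc j)))"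

text \<open>\<open>\<parallel>X \<beta> - y\<parallel>\<^sup>2\<close> divided by the number of rows of \<open>X\<close>.\<close>

definition mean_sq_loss :: "real mat \<Rightarrow> real vec \<Rightarrow> real vec \<Rightarrow> real" where
  "mean_sq_loss X y \<beta> =
     scalar_prod (X *\<^sub>v \<beta> - y) (X *\<^sub>v \<beta> - y) / real (dim_row X)"

definition set_entry :: "weights \<Rightarrow> nat \<Rightarrow> nat \<times> nat \<Rightarrow> real \<Rightarrow> weights" where
  "set_entry W j p u =
     W(j := mat (dim_row (W j)) (dim_col (W j)) (\<lambda>q. if q = p then u else W j $$ q))"

definition partial_deriv :: "(weights \<Rightarrow> real) \<Rightarrow> weights \<Rightarrow> nat \<Rightarrow> nat \<times> nat \<Rightarrow> real" where
  "partial_deriv loss W j p = deriv (\<lambda>u. loss (set_entry W j p u)) (W j $$ p)"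

text \<open>Gradient flow of \<open>loss\<close> on the time interval \<open>[0, \<infinity>)\<close> (one-sided derivative at time 0) for the
  layers in \<open>J\<close>. Nothing is said about the evolution of the layers outside \<open>J\<close>.\<close>

definition gradient_flow ::
  "(nat \<Rightarrow> nat) \<Rightarrow> (weights \<Rightarrow> real) \<Rightarrow> nat set \<Rightarrow> (real \<Rightarrow> weights) \<Rightarrow> bool" where
  "gradient_flow dims loss J W \<longleftrightarrow>
     (\<forall>t\<ge>0. \<forall>j\<in>J. \<forall>a < dims (j - 1). \<forall>b < dims j.
        ((\<lambda>s. W s j $$ (a, b)) has_real_derivative - partial_deriv loss (W t) j (a, b))
          (at t within {0..}))"

definition weights_tendsto ::
  "nat \<Rightarrow> (nat \<Rightarrow> nat) \<Rightarrow> (real \<Rightarrow> weights) \<Rightarrow> weights \<Rightarrow> bool" where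
  "weights_tendsto L dims P W \<longleftrightarrow>
     (\<forall>j\<in>{1..L}. \<forall>a < dims (j - 1). \<forall>b < dims j.
        ((\<lambda>s. P s j $$ (a, b)) \<longlongrightarrow> W j $$ (a, b)) at_top)"

end

theory Submission
  imports Defs
begin

text \<open>The quantities \<open>W\<^sub>j\<^sup>T W\<^sub>j - W\<^sub>j\<^sub>+\<^sub>1 W\<^sub>j\<^sub>+\<^sub>1\<^sup>T\<close> are conserved by gradient flow on any mean squared loss of
  the end-to-end vector, so the pretrained weights, being a limit of 0-balanced weights, are
  0-balanced. For 0-balanced weights every \<open>x\<close> orthogonal to the end-to-end vector satisfies
  \<open>W\<^sub>1\<^sup>T x = 0\<close>: descending through the layers, \<open>W\<^sub>2\<^sup>T W\<^sub>1\<^sup>T x = 0\<close> gives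
  \<open>W\<^sub>1\<^sup>T W\<^sub>1 W\<^sub>1\<^sup>T x = W\<^sub>2 W\<^sub>2\<^sup>T W\<^sub>1\<^sup>T x = 0\<close>, hence \<open>W\<^sub>1\<^sup>T x = 0\<close>. So the column space of the frozen first
  layer lies in the line spanned by \<open>\<theta>\<^sub>S\<close> (and is zero if \<open>\<theta>\<^sub>S = 0\<close>), and \<open>\<beta>(t)\<close> stays in it.\<close>

section \<open>Partial products of the layers\<close>

fun head_prod :: "nat \<Rightarrow> weights \<Rightarrow> nat \<Rightarrow> real mat" where
  "head_prod d W 0 = 1\<^sub>m d"
| "head_prod d W (Suc i) = head_prod d W i * W (Suc i)"

text \<open>The fold of \<open>end_to_end\<close>, started at layer \<open>j\<close>. For
  \<open>j = Suc L\<close> it is the vector of length 1 with entry 1, so that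
  \<open>tail_vec_step\<close> also covers the last layer.\<close>

definition tail_vec :: "nat \<Rightarrow> weights \<Rightarrow> nat \<Rightarrow> real vec" where
  "tail_vec L W j = col (foldr (\<lambda>j M. W j * M) [j..<Suc L] (1\<^sub>m 1)) 0"

lemma is_weightsD:
  "is_weights L dims W \<Longrightarrow> i < L \<Longrightarrow> W (Suc i) \<in> carrier_mat (dims i) (dims (Suc i))"
  by (force simp: is_weights_def)

lemma end_to_end_eq_tail_vec: "end_to_end L W = tail_vec L W 1"
  by (simp add: end_to_end_def tail_vec_def)

lemma tail_prod_carrier:
  assumes "is_weights L dims W" "dims L = 1" "i \<le> L"
  shows "foldr (\<lambda>j M. W j * M) [Suc i..<Suc L] (1\<^sub>m 1) \<in> carrier_mat (dims i) 1"
  using assms(3)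
proof (induction rule: inc_induct)
  case base
  then show ?case using assms by simp
next
  case (step m)
  then show ?case
    using is_weightsD[OF assms(1), of m]
    by (auto simp: upt_conv_Cons simp del: upt_Suc)
qed

lemma tail_vec_carrier:
  assumes "is_weights L dims W" "dims L = 1" "i \<le> L"
  shows "tail_vec L W (Suc i) \<in> carrier_vec (dims i)"
  using tail_prod_carrier[OF assms] unfolding tail_vec_def
  by (metis carrier_matD(1) carrier_vecI dim_col)

lemma tail_vec_last: "tail_vec L W (Suc L) = unit_vec 1 0"
  by (simp add: tail_vec_def)

lemma tail_vec_step:
  assumes "is_weights L dims W" "dims L = 1" "i < L"
  shows "tail_vec L W (Suc i) = W (Suc i) *\<^sub>v tail_vec L W (Suc (Suc i))"
proof -
  have "tail_vec L W (Suc i) =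
      col (W (Suc i) * foldr (\<lambda>j M. W j * M) [Suc (Suc i)..<Suc L] (1\<^sub>m 1)) 0"
    using assms(3) by (simp add: tail_vec_def upt_conv_Cons del: upt_Suc)
  also have "\<dots> = W (Suc i) *\<^sub>v tail_vec L W (Suc (Suc i))"
    unfolding tail_vec_def
    using col_mult2[OF is_weightsD[OF assms(1,3)] tail_prod_carrier[OF assms(1,2) Suc_leI[OF assms(3)]]]
    by simp
  finally show ?thesis .
qed

lemma head_prod_carrier:
  assumes "is_weights L dims W" "dims 0 = d" "i \<le> L"
  shows "head_prod d W i \<in> carrier_mat d (dims i)"
  using assms(3)
proof (induction i)
  case (Suc i)
  then show ?case using is_weightsD[OF assms(1), of i] by auto
qed (use assms(2) in simp)

text \<open>By associativity, layers move one at a time from the tail to the head. Together with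
  \<open>tail_vec_step\<close> this isolates a single layer between two factors that do not contain
  it.\<close>

lemma end_to_end_split:
  assumes "is_weights L dims W" "dims 0 = d" "dims L = 1" "i \<le> L"
  shows "end_to_end L W = head_prod d W i *\<^sub>v tail_vec L W (Suc i)"
  using assms(4)
proof (induction i)
  case 0
  show ?case using tail_vec_carrier[OF assms(1,3), of 0] assms(2)
    by (simp add: end_to_end_eq_tail_vec)
next
  case (Suc i)
  have i: "i < L" using Suc by simp
  have "end_to_end L W = head_prod d W i *\<^sub>v (W (Suc i) *\<^sub>v tail_vec L W (Suc (Suc i)))"
    using Suc i by (simp add: tail_vec_step[OF assms(1,3)])
  also have "\<dots> = head_prod d W (Suc i) *\<^sub>v tail_vec L W (Suc (Suc i))"
    using assoc_mult_mat_vec[OF head_prod_carrier[OF assms(1,2)] is_weightsD[OF assms(1) i]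
        tail_vec_carrier[OF assms(1,3)]] i Suc.prems by simp
  finally show ?case .
qed

lemma end_to_end_carrier:
  assumes "is_weights L dims W" "dims 0 = d" "dims L = 1"
  shows "end_to_end L W \<in> carrier_vec d"
  using tail_vec_carrier[OF assms(1,3), of 0] assms(2) by (simp add: end_to_end_eq_tail_vec)

lemma head_prod_cong:
  "(\<And>m. 1 \<le> m \<Longrightarrow> m \<le> i \<Longrightarrow> W m = W' m) \<Longrightarrow> head_prod d W i = head_prod d W' i"
  by (induction i) auto

lemma tail_vec_cong:
  assumes "\<And>m. i \<le> m \<Longrightarrow> m \<le> L \<Longrightarrow> W m = W' m"
  shows "tail_vec L W i = tail_vec L W' i"
proof -
  have "foldr (\<lambda>j M. W j * M) [i..<Suc L] (1\<^sub>m 1) = foldr (\<lambda>j M. W' j * M) [i..<Suc L] (1\<^sub>m 1)"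
    using assms by (intro foldr_cong) auto
  then show ?thesis by (simp add: tail_vec_def)
qed

section \<open>The loss gradient in a single layer\<close>

lemma set_entry_carrier:
  assumes "W m \<in> carrier_mat k l"
  shows "set_entry W j p u m \<in> carrier_mat k l"
proof (cases "m = j")
  case True
  have "set_entry W j p u j \<in> carrier_mat (dim_row (W j)) (dim_col (W j))"
    unfolding set_entry_def fun_upd_same by (rule mat_carrier)
  then show ?thesis using assms True by simp
next
  case False
  then show ?thesis using assms by (simp add: set_entry_def)
qed

lemma is_weights_set_entry: "is_weights L dims W \<Longrightarrow> is_weights L dims (set_entry W j p u)"
  unfolding is_weights_def by (blast intro: set_entry_carrier)

text \<open>Overwriting entry \<open>(a, b)\<close> adds a multiple of the matrix unit at
  \<open>(a, b)\<close>, which sends \<open>v\<close> to its entry \<open>b\<close> times the unit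
  vector at \<open>a\<close>.\<close>

lemma set_entry_mult_vec:
  assumes "W j \<in> carrier_mat m l" "v \<in> carrier_vec l" "a < m" "b < l"
  shows "set_entry W j (a, b) u j *\<^sub>v v =
    W j *\<^sub>v v + ((u - W j $$ (a, b)) * vec_index v b) \<cdot>\<^sub>v unit_vec m a"
proof (rule eq_vecI)
  fix i assume "i < dim_vec (W j *\<^sub>v v + ((u - W j $$ (a, b)) * vec_index v b) \<cdot>\<^sub>v unit_vec m a)"
  then have i: "i < m" by simp
  have "vec_index (set_entry W j (a, b) u j *\<^sub>v v) i =
      (\<Sum>c = 0..<l. (if (i, c) = (a, b) then u else W j $$ (i, c)) * vec_index v c)"
    using assms i by (auto simp: set_entry_def scalar_prod_def intro!: sum.cong)
  also have "\<dots> = (\<Sum>c = 0..<l. W j $$ (i, c) * vec_index v c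
      + (if c = b then (if i = a then (u - W j $$ (a, b)) * vec_index v b else 0) else 0))"
    by (intro sum.cong) (auto simp: algebra_simps)
  also have "\<dots> = (\<Sum>c = 0..<l. W j $$ (i, c) * vec_index v c)
      + (if i = a then (u - W j $$ (a, b)) * vec_index v b else 0)"
    using assms by (simp add: sum.distrib)
  also have "\<dots> = vec_index (W j *\<^sub>v v + ((u - W j $$ (a, b)) * vec_index v b) \<cdot>\<^sub>v unit_vec m a) i"
    using assms i by (auto simp: scalar_prod_def)
  finally show "vec_index (set_entry W j (a, b) u j *\<^sub>v v) i =
      vec_index (W j *\<^sub>v v + ((u - W j $$ (a, b)) * vec_index v b) \<cdot>\<^sub>v unit_vec m a) i" .
qed (use assms in \<open>simp add: set_entry_def\<close>)

text \<open>The head before layer \<open>Suc i\<close> and the tail after it do not see the change,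
  so the product is affine in the changed entry.\<close>

lemma end_to_end_set_entry:
  assumes W: "is_weights L dims W" and d: "dims 0 = d" "dims L = 1" and i: "i < L"
    and a: "a < dims i" and b: "b < dims (Suc i)"
  shows "end_to_end L (set_entry W (Suc i) (a, b) u) = end_to_end L W +
    ((u - W (Suc i) $$ (a, b)) * vec_index (tail_vec L W (Suc (Suc i))) b) \<cdot>\<^sub>v col (head_prod d W i) a"
proof -
  let ?W' = "set_entry W (Suc i) (a, b) u" and ?q = "tail_vec L W (Suc (Suc i))"
  let ?H = "head_prod d W i" and ?r = "(u - W (Suc i) $$ (a, b)) * vec_index (tail_vec L W (Suc (Suc i))) b"
  have H: "?H \<in> carrier_mat d (dims i)" using head_prod_carrier[OF W d(1)] i by simp
  have q: "?q \<in> carrier_vec (dims (Suc i))" using tail_vec_carrier[OF W d(2)] i by simp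
  note Wi = is_weightsD[OF W i]
  have "end_to_end L ?W' = head_prod d ?W' i *\<^sub>v (?W' (Suc i) *\<^sub>v tail_vec L ?W' (Suc (Suc i)))"
    using end_to_end_split[OF is_weights_set_entry[OF W] d less_imp_le[OF i]]
      tail_vec_step[OF is_weights_set_entry[OF W] d(2) i]
    by metis
  also have "\<dots> = ?H *\<^sub>v (?W' (Suc i) *\<^sub>v ?q)"
    using head_prod_cong[of i ?W' W d] tail_vec_cong[of "Suc (Suc i)" L ?W' W]
    by (simp add: set_entry_def)
  also have "\<dots> = ?H *\<^sub>v (W (Suc i) *\<^sub>v ?q + ?r \<cdot>\<^sub>v unit_vec (dims i) a)"
    using set_entry_mult_vec[of W "Suc i", OF Wi q a b] by simp
  also have "\<dots> = ?H *\<^sub>v (W (Suc i) *\<^sub>v ?q) + ?r \<cdot>\<^sub>v (?H *\<^sub>v unit_vec (dims i) a)"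
    using H Wi q by (simp add: mult_add_distrib_mat_vec[OF H] mult_mat_vec[OF H])
  also have "?H *\<^sub>v unit_vec (dims i) a = col ?H a"
    using H a by (intro eq_vecI) auto
  also have "?H *\<^sub>v (W (Suc i) *\<^sub>v ?q) = end_to_end L W"
    using end_to_end_split[OF W d, of i] tail_vec_step[OF W d(2) i] i by simp
  finally show ?thesis .
qed

text \<open>Along a line the loss is a quadratic polynomial in the parameter; centring the line at
  \<open>u0\<close> leaves only the linear coefficient as derivative there.\<close>

lemma mean_sq_loss_line_deriv:
  assumes X: "X \<in> carrier_mat n d" and y: "y \<in> carrier_vec n"
    and \<beta>: "\<beta> \<in> carrier_vec d" and v: "v \<in> carrier_vec d"
  shows "((\<lambda>u. mean_sq_loss X y (\<beta> + ((u - u0) * k) \<cdot>\<^sub>v v)) has_real_derivative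
    2 / real n * k * scalar_prod (X *\<^sub>v \<beta> - y) (X *\<^sub>v v)) (at u0)"
proof -
  let ?r = "X *\<^sub>v \<beta> - y" and ?w = "X *\<^sub>v v"
  have r: "?r \<in> carrier_vec n" and w: "?w \<in> carrier_vec n" using assms by auto
  have eq: "mean_sq_loss X y (\<beta> + ((u - u0) * k) \<cdot>\<^sub>v v) =
      (\<Sum>i = 0..<n. (vec_index ?r i + (u - u0) * k * vec_index ?w i)\<^sup>2) / real n" for u
  proof -
    have "X *\<^sub>v (\<beta> + ((u - u0) * k) \<cdot>\<^sub>v v) - y = ?r + ((u - u0) * k) \<cdot>\<^sub>v ?w"
      using assms by (intro eq_vecI) (auto simp: mult_add_distrib_mat_vec[OF X] mult_mat_vec[OF X])
    then show ?thesis
      using r w X by (simp add: mean_sq_loss_def scalar_prod_def power2_eq_square)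
  qed
  have "((\<lambda>u. (\<Sum>i = 0..<n. (vec_index ?r i + (u - u0) * k * vec_index ?w i)\<^sup>2) / real n)
      has_real_derivative (\<Sum>i = 0..<n. 2 * (vec_index ?r i + (u0 - u0) * k * vec_index ?w i)
        * (k * vec_index ?w i)) / real n) (at u0)"
    by (intro DERIV_cdivide DERIV_sum) (auto intro!: derivative_eq_intros)
  moreover have "(\<Sum>i = 0..<n. 2 * (vec_index ?r i + (u0 - u0) * k * vec_index ?w i)
        * (k * vec_index ?w i)) / real n = 2 / real n * k * scalar_prod ?r ?w"
    using X by (simp add: scalar_prod_def[of ?r] sum_distrib_left sum_divide_distrib mult_ac del: index_mult_mat_vec)
  ultimately show ?thesis unfolding eq by (rule DERIV_cong)
qed

text \<open>The vector to which the transposed head is applied is the gradient of the mean squared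
  loss with respect to the end-to-end vector; the head pulls it back to the output side of layer
  \<open>i\<close>, as in backpropagation.\<close>

definition head_grad :: "real mat \<Rightarrow> real vec \<Rightarrow> nat \<Rightarrow> weights \<Rightarrow> nat \<Rightarrow> real vec" where
  "head_grad X y L W i = transpose_mat (head_prod (dim_col X) W i) *\<^sub>v
     (2 / real (dim_row X) \<cdot>\<^sub>v (transpose_mat X *\<^sub>v (X *\<^sub>v end_to_end L W - y)))"

text \<open>The loss gradient in layer \<open>i + 1\<close> is the rank-one matrix
  \<open>head_grad X y L W i * (tail_vec L W (i + 2))\<^sup>T\<close>.\<close>

lemma partial_deriv_mean_sq_loss:
  assumes W: "is_weights L dims W" and d: "dims 0 = d" "dims L = 1" and i: "i < L"
    and a: "a < dims i" and b: "b < dims (Suc i)"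
    and X: "X \<in> carrier_mat n d" and y: "y \<in> carrier_vec n"
  shows "partial_deriv (\<lambda>U. mean_sq_loss X y (end_to_end L U)) W (Suc i) (a, b) =
    vec_index (head_grad X y L W i) a * vec_index (tail_vec L W (Suc (Suc i))) b"
proof -
  let ?H = "head_prod d W i" and ?r = "X *\<^sub>v end_to_end L W - y"
  have H: "?H \<in> carrier_mat d (dims i)" using head_prod_carrier[OF W d(1)] i by simp
  have c: "col ?H a \<in> carrier_vec d" using H by (metis carrier_matD(1) carrier_vecI dim_col)
  have r: "?r \<in> carrier_vec n" using X y end_to_end_carrier[OF W d] by simp
  have "partial_deriv (\<lambda>U. mean_sq_loss X y (end_to_end L U)) W (Suc i) (a, b) =
     2 / real n * vec_index (tail_vec L W (Suc (Suc i))) b * scalar_prod ?r (X *\<^sub>v col ?H a)"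
    unfolding partial_deriv_def end_to_end_set_entry[OF W d i a b]
    by (rule DERIV_imp_deriv, rule mean_sq_loss_line_deriv[OF X y end_to_end_carrier[OF W d] c])
  also have "scalar_prod ?r (X *\<^sub>v col ?H a) = scalar_prod (transpose_mat X *\<^sub>v ?r) (col ?H a)"
    using transpose_vec_mult_scalar[OF X c r] by (rule sym)
  also have "\<dots> = scalar_prod (col ?H a) (transpose_mat X *\<^sub>v ?r)"
    using c X by (intro comm_scalar_prod[OF _ c] carrier_vecI) simp
  finally show ?thesis using H a X by (simp add: head_grad_def mult_ac)
qed

text \<open>Transposing \<open>head_prod d W (Suc i) = head_prod d W i * W (Suc i)\<close> puts the
  new layer on the left. This is the counterpart for heads of \<open>tail_vec_step\<close>.\<close>

lemma head_grad_step:
  assumes W: "is_weights L dims W" and d: "dims 0 = d" and X: "X \<in> carrier_mat n d"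
    and i: "i < L" and b: "b < dims (Suc i)"
  shows "vec_index (head_grad X y L W (Suc i)) b =
    (\<Sum>a<dims i. W (Suc i) $$ (a, b) * vec_index (head_grad X y L W i) a)"
proof -
  let ?H = "head_prod (dim_col X) W i"
  let ?g = "2 / real (dim_row X) \<cdot>\<^sub>v (transpose_mat X *\<^sub>v (X *\<^sub>v end_to_end L W - y))"
  have g: "?g \<in> carrier_vec d" using X by (intro carrier_vecI) simp
  have H: "?H \<in> carrier_mat d (dims i)"
    using head_prod_carrier[OF W d, of i] X i by simp
  note Wi = is_weightsD[OF W i]
  have HT: "transpose_mat ?H \<in> carrier_mat (dims i) d"
    and WT: "transpose_mat (W (Suc i)) \<in> carrier_mat (dims (Suc i)) (dims i)"
    using H Wi by auto
  have "head_grad X y L W (Suc i) = transpose_mat (W (Suc i)) *\<^sub>v head_grad X y L W i"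
    using assoc_mult_mat_vec[OF WT HT g] by (simp add: head_grad_def transpose_mult[OF H Wi])
  moreover have "dim_vec (head_grad X y L W i) = dims i"
    using H by (simp add: head_grad_def)
  ultimately show ?thesis
    using Wi b by (simp add: scalar_prod_def lessThan_atLeast0)
qed

section \<open>Conservation of the balance along gradient flow\<close>

lemma gradient_flow_deriv:
  assumes W: "\<And>s. s \<ge> 0 \<Longrightarrow> is_weights L dims (W s)" and d: "dims 0 = d" "dims L = 1"
    and X: "X \<in> carrier_mat n d" and y: "y \<in> carrier_vec n"
    and flow: "gradient_flow dims (\<lambda>U. mean_sq_loss X y (end_to_end L U)) {1..L} W"
    and t: "t \<ge> 0" and i: "i < L" and a: "a < dims i" and b: "b < dims (Suc i)"
  shows "((\<lambda>s. W s (Suc i) $$ (a, b)) has_real_derivative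
    - (vec_index (head_grad X y L (W t) i) a * vec_index (tail_vec L (W t) (Suc (Suc i))) b))
    (at t within {0..})"
proof -
  have "Suc i \<in> {1..L}" using i by simp
  then have "((\<lambda>s. W s (Suc i) $$ (a, b)) has_real_derivative
      - partial_deriv (\<lambda>U. mean_sq_loss X y (end_to_end L U)) (W t) (Suc i) (a, b)) (at t within {0..})"
    using flow t a b unfolding gradient_flow_def by (metis diff_Suc_1)
  then show ?thesis
    unfolding partial_deriv_mean_sq_loss[OF W[OF t] d i a b X y] .
qed

text \<open>Entry \<open>(b, c)\<close> of \<open>W\<^sub>j\<^sup>T W\<^sub>j -
  W\<^sub>j\<^sub>+\<^sub>1 W\<^sub>j\<^sub>+\<^sub>1\<^sup>T\<close> for \<open>j = Suc i\<close>,
  kept as a scalar because derivatives and limits are taken entrywise.\<close>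

definition balance_defect :: "(nat \<Rightarrow> nat) \<Rightarrow> weights \<Rightarrow> nat \<Rightarrow> nat \<Rightarrow> nat \<Rightarrow> real" where
  "balance_defect dims W i b c =
     (\<Sum>a<dims i. W (Suc i) $$ (a, b) * W (Suc i) $$ (a, c)) -
     (\<Sum>e<dims (Suc (Suc i)). W (Suc (Suc i)) $$ (b, e) * W (Suc (Suc i)) $$ (c, e))"

lemma zero_balanced_iff_defect:
  assumes W: "is_weights L dims W"
  shows "zero_balanced L W \<longleftrightarrow>
    (\<forall>i b c. Suc i < L \<longrightarrow> b < dims (Suc i) \<longrightarrow> c < dims (Suc i) \<longrightarrow> balance_defect dims W i b c = 0)"
proof -
  have "transpose_mat (W (Suc i)) * W (Suc i) = W (Suc (Suc i)) * transpose_mat (W (Suc (Suc i)))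
      \<longleftrightarrow> (\<forall>b<dims (Suc i). \<forall>c<dims (Suc i). balance_defect dims W i b c = 0)" if "Suc i < L" for i
  proof -
    have A: "W (Suc i) \<in> carrier_mat (dims i) (dims (Suc i))"
      and B: "W (Suc (Suc i)) \<in> carrier_mat (dims (Suc i)) (dims (Suc (Suc i)))"
      using is_weightsD[OF W] that by auto
    have "(transpose_mat (W (Suc i)) * W (Suc i)) $$ (b, c) -
        (W (Suc (Suc i)) * transpose_mat (W (Suc (Suc i)))) $$ (b, c) = balance_defect dims W i b c"
      if "b < dims (Suc i)" "c < dims (Suc i)" for b c
      using A B that by (simp add: balance_defect_def scalar_prod_def lessThan_atLeast0)
    then show ?thesis using A B by (auto simp: mat_eq_iff)
  qed
  moreover have "zero_balanced L W \<longleftrightarrow> (\<forall>i. Suc i < L \<longrightarrow>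
      transpose_mat (W (Suc i)) * W (Suc i) = W (Suc (Suc i)) * transpose_mat (W (Suc (Suc i))))"
  proof (intro iffI allI impI)
    fix i assume "zero_balanced L W" "Suc i < L"
    then show "transpose_mat (W (Suc i)) * W (Suc i) = W (Suc (Suc i)) * transpose_mat (W (Suc (Suc i)))"
      by (simp add: zero_balanced_def)
  next
    assume *: "\<forall>i. Suc i < L \<longrightarrow>
      transpose_mat (W (Suc i)) * W (Suc i) = W (Suc (Suc i)) * transpose_mat (W (Suc (Suc i)))"
    have "transpose_mat (W j) * W j = W (Suc j) * transpose_mat (W (Suc j))"
      if "1 \<le> j" "j \<le> L - 1" for j
      using * that by (cases j) auto
    then show "zero_balanced L W" by (simp add: zero_balanced_def)
  qed
  ultimately show ?thesis by blast
qed

text \<open>Both gradients have rank one. With \<open>p\<close> the head gradient and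
  \<open>q\<close> the tail between the two layers, each of the two Gram matrices has derivative
  \<open>- (p q\<^sup>T + q p\<^sup>T)\<close>, so the difference is stationary.\<close>

lemma balance_defect_deriv:
  assumes W: "\<And>s. s \<ge> 0 \<Longrightarrow> is_weights L dims (W s)" and d: "dims 0 = d" "dims L = 1"
    and X: "X \<in> carrier_mat n d" and y: "y \<in> carrier_vec n"
    and flow: "gradient_flow dims (\<lambda>U. mean_sq_loss X y (end_to_end L U)) {1..L} W"
    and t: "t \<ge> 0" and i: "Suc i < L" and b: "b < dims (Suc i)" and c: "c < dims (Suc i)"
  shows "((\<lambda>s. balance_defect dims (W s) i b c) has_real_derivative 0) (at t within {0..})"
proof -
  let ?W1 = "W t (Suc i)" and ?W2 = "W t (Suc (Suc i))" and ?m = "dims (Suc (Suc i))"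
  \<comment> \<open>With this offset \<open>?p i\<close> and \<open>?q i\<close> both have length
    \<open>dims i\<close>, and the gradient in layer \<open>Suc i\<close> is \<open>?p i\<close>
    times \<open>?q (Suc i)\<close>.\<close>
  let ?q = "\<lambda>i. vec_index (tail_vec L (W t) (Suc i))"
  let ?p = "\<lambda>i. vec_index (head_grad X y L (W t) i)"
  have D: "((\<lambda>s. W s (Suc i) $$ (a, b)) has_real_derivative - (?p i a * ?q (Suc i) b)) (at t within {0..})"
    if "i < L" "a < dims i" "b < dims (Suc i)" for i a b
    using gradient_flow_deriv[OF W d X y flow t that] .
  have p: "?p (Suc i) b = (\<Sum>a<dims i. ?W1 $$ (a, b) * ?p i a)" if "b < dims (Suc i)" for b
    using head_grad_step[OF W[OF t] d(1) X _ that] i by simp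
  have q: "?q (Suc i) b = (\<Sum>e<?m. ?W2 $$ (b, e) * ?q (Suc (Suc i)) e)" if "b < dims (Suc i)" for b
    using that is_weightsD[OF W[OF t] i] tail_vec_carrier[OF W[OF t] d(2), of "Suc (Suc i)"] i
    by (simp add: tail_vec_step[OF W[OF t] d(2) i] scalar_prod_def lessThan_atLeast0)
  have "((\<lambda>s. balance_defect dims (W s) i b c) has_real_derivative
      (\<Sum>a<dims i. - (?p i a * ?q (Suc i) b) * ?W1 $$ (a, c) + - (?p i a * ?q (Suc i) c) * ?W1 $$ (a, b))
      - (\<Sum>e<?m. - (?p (Suc i) b * ?q (Suc (Suc i)) e) * ?W2 $$ (c, e)
          + - (?p (Suc i) c * ?q (Suc (Suc i)) e) * ?W2 $$ (b, e))) (at t within {0..})"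
    unfolding balance_defect_def
    using i b c by (intro DERIV_diff DERIV_sum DERIV_mult D) auto
  also have "(\<Sum>a<dims i. - (?p i a * ?q (Suc i) b) * ?W1 $$ (a, c) + - (?p i a * ?q (Suc i) c) * ?W1 $$ (a, b))
      = - (?q (Suc i) b * ?p (Suc i) c) - ?q (Suc i) c * ?p (Suc i) b"
    using i b c by (simp add: p sum_distrib_left sum_subtractf sum_negf mult_ac)
  also have "(\<Sum>e<?m. - (?p (Suc i) b * ?q (Suc (Suc i)) e) * ?W2 $$ (c, e)
          + - (?p (Suc i) c * ?q (Suc (Suc i)) e) * ?W2 $$ (b, e))
      = - (?p (Suc i) b * ?q (Suc i) c) - ?p (Suc i) c * ?q (Suc i) b"
    unfolding q[OF b] q[OF c] by (simp add: sum_distrib_left sum_subtractf sum_negf mult_ac)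
  finally show ?thesis by (simp add: mult_ac)
qed

text \<open>A vanishing derivative on the half-line keeps each defect at its initial value 0; being
  polynomial in the entries, the defects pass to the limit.\<close>

lemma zero_balanced_limit:
  assumes W: "\<And>s. s \<ge> 0 \<Longrightarrow> is_weights L dims (W s)" and d: "dims 0 = d" "dims L = 1"
    and X: "X \<in> carrier_mat n d" and y: "y \<in> carrier_vec n"
    and flow: "gradient_flow dims (\<lambda>U. mean_sq_loss X y (end_to_end L U)) {1..L} W"
    and bal: "zero_balanced L (W 0)"
    and lim: "weights_tendsto L dims W W'" and W': "is_weights L dims W'"
  shows "zero_balanced L W'"
  unfolding zero_balanced_iff_defect[OF W']
proof (intro allI impI)
  fix i b c assume i: "Suc i < L" and b: "b < dims (Suc i)" and c: "c < dims (Suc i)"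
  let ?D = "\<lambda>s. balance_defect dims (W s) i b c"
  have "\<exists>k. \<forall>s\<in>{0..}. ?D s = k"
    using balance_defect_deriv[OF W d X y flow _ i b c]
    by (intro has_field_derivative_zero_constant) auto
  moreover have "?D 0 = 0"
    using bal i b c W[of 0] by (simp add: zero_balanced_iff_defect)
  ultimately have "?D s = 0" if "s \<ge> 0" for s
    using that by (metis atLeast_iff order_refl)
  then have "(?D \<longlongrightarrow> 0) at_top"
    by (intro tendsto_eventually) (auto simp: eventually_at_top_linorder)
  moreover have *: "((\<lambda>s. W s (Suc j) $$ (a, e)) \<longlongrightarrow> W' (Suc j) $$ (a, e)) at_top"
    if "j < L" "a < dims j" "e < dims (Suc j)" for j a e
    using lim that unfolding weights_tendsto_def by force
  have "(?D \<longlongrightarrow> balance_defect dims W' i b c) at_top"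
    unfolding balance_defect_def using i b c by (intro tendsto_intros *) auto
  ultimately show "balance_defect dims W' i b c = 0"
    using tendsto_unique[of at_top ?D] by simp
qed

section \<open>Kernels of 0-balanced layers\<close>

lemma mult_mat_vec_eq_0_if_gram:
  fixes A :: "real mat"
  assumes A: "A \<in> carrier_mat m l" and v: "v \<in> carrier_vec l"
    and "transpose_mat A *\<^sub>v (A *\<^sub>v v) = 0\<^sub>v l"
  shows "A *\<^sub>v v = 0\<^sub>v m"
proof -
  have Av: "A *\<^sub>v v \<in> carrier_vec m" using A v by simp
  \<comment> \<open>The squared norm of \<open>A v\<close> is the pairing of
    \<open>A\<^sup>T A v\<close> with \<open>v\<close>.\<close>
  have "scalar_prod (A *\<^sub>v v) (A *\<^sub>v v) = 0"
    using transpose_vec_mult_scalar[OF A v Av] assms(3) v by simp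
  then have "(\<Sum>i = 0..<m. (vec_index (A *\<^sub>v v) i)\<^sup>2) = 0"
    using A by (simp add: scalar_prod_def power2_eq_square del: index_mult_mat_vec)
  then have "\<forall>i<m. vec_index (A *\<^sub>v v) i = 0"
    by (simp add: sum_nonneg_eq_0_iff del: index_mult_mat_vec)
  then show ?thesis using A by (intro eq_vecI) (auto simp del: index_mult_mat_vec)
qed

lemma zero_balanced_kernel:
  assumes W: "is_weights L dims W" and dL: "dims L = 1" and bal: "zero_balanced L W"
    and i: "Suc i \<le> L" and x: "x \<in> carrier_vec (dims i)"
    and orth: "scalar_prod x (tail_vec L W (Suc i)) = 0"
  shows "transpose_mat (W (Suc i)) *\<^sub>v x = 0\<^sub>v (dims (Suc i))"
proof -
  \<comment> \<open>Orthogonality to the tail is handed to the next layer by adjointness; this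
    supplies the premise of the induction hypothesis.\<close>
  have shift: "scalar_prod (transpose_mat (W (Suc i)) *\<^sub>v x) (tail_vec L W (Suc (Suc i))) = 0"
    if "Suc i \<le> L" "x \<in> carrier_vec (dims i)" "scalar_prod x (tail_vec L W (Suc i)) = 0" for i x
    using that transpose_vec_mult_scalar[OF is_weightsD[OF W] tail_vec_carrier[OF W dL], of i x]
      tail_vec_step[OF W dL, of i] by simp
  \<comment> \<open>The induction descends from the last layer \<open>Suc m\<close>.\<close>
  obtain m where L: "L = Suc m" using i by (cases L) auto
  have "i \<le> m" using i L by simp
  then show ?thesis using x orth
  proof (induction arbitrary: x rule: inc_induct)
    case base
    let ?z = "transpose_mat (W (Suc m)) *\<^sub>v x"
    have Wm: "W (Suc m) \<in> carrier_mat (dims m) (dims (Suc m))" using is_weightsD[OF W] L by simp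
    have z: "?z \<in> carrier_vec 1" using Wm dL L by (intro carrier_vecI) simp
    \<comment> \<open>Past the last layer the tail is the unit vector of length 1, so the only entry
      of \<open>?z\<close> vanishes.\<close>
    have "scalar_prod ?z (unit_vec 1 0) = 0"
      using shift[of m x] base L tail_vec_last[of L W] by simp
    then have "vec_index ?z 0 = 0" using z by (simp add: scalar_prod_right_unit[of _ 1])
    then show ?case using Wm dL L by (intro eq_vecI) (auto simp del: index_mult_mat_vec)
  next
    case (step i)
    let ?A = "W (Suc i)" and ?B = "W (Suc (Suc i))"
    let ?z = "transpose_mat ?A *\<^sub>v x"
    have iL: "Suc i < L" using step L by simp
    have A: "?A \<in> carrier_mat (dims i) (dims (Suc i))"
      and B: "?B \<in> carrier_mat (dims (Suc i)) (dims (Suc (Suc i)))"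
      using is_weightsD[OF W] iL by auto
    have AT: "transpose_mat ?A \<in> carrier_mat (dims (Suc i)) (dims i)"
      and BT: "transpose_mat ?B \<in> carrier_mat (dims (Suc (Suc i))) (dims (Suc i))"
      using A B by auto
    have z: "?z \<in> carrier_vec (dims (Suc i))" using AT step.prems by simp
    have "transpose_mat ?B *\<^sub>v ?z = 0\<^sub>v (dims (Suc (Suc i)))"
      using step.IH z shift step.prems iL by simp
    then have "(?B * transpose_mat ?B) *\<^sub>v ?z = 0\<^sub>v (dims (Suc i))"
      using B assoc_mult_mat_vec[OF B BT z] by (auto intro!: eq_vecI)
    moreover have "transpose_mat ?A * ?A = ?B * transpose_mat ?B"
      using bal iL by (simp add: zero_balanced_def)
    ultimately have "transpose_mat ?A *\<^sub>v (?A *\<^sub>v ?z) = 0\<^sub>v (dims (Suc i))"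
      using assoc_mult_mat_vec[OF AT A z] by simp
    \<comment> \<open>The Gram argument is used twice: for \<open>?A\<close> at \<open>?z\<close> it
      gives \<open>?A ?A\<^sup>T x = 0\<close>, and then for the transpose of \<open>?A\<close> at
      \<open>x\<close>.\<close>
    then have "?A *\<^sub>v ?z = 0\<^sub>v (dims i)" by (rule mult_mat_vec_eq_0_if_gram[OF A z])
    then show ?case using mult_mat_vec_eq_0_if_gram[OF AT step.prems(1)] by simp
  qed
qed

section \<open>Fine-tuning with frozen first layers\<close>

theorem theorem5p5:
  fixes n d L k nS :: nat
    and dims :: "nat \<Rightarrow> nat"
    and X XS :: "real mat"
    and \<theta>S \<theta>T y :: "real vec"
    and P V W :: "real \<Rightarrow> weights"
  assumes "1 \<le> n" and "n < d"
    and "X \<in> carrier_mat n d" and "invertible_mat (X * transpose_mat X)"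
    and "\<theta>S \<in> carrier_vec d" and "\<theta>T \<in> carrier_vec d" and "y = X *\<^sub>v \<theta>T"
    and "1 \<le> L" and "admissible_dims d L dims"
    \<comment> \<open>pretraining \<open>P\<close>\<close>
    and "1 \<le> nS" and "XS \<in> carrier_mat nS d"
    and "\<And>s. s \<ge> 0 \<Longrightarrow> is_weights L dims (P s)"
    and "zero_balanced L (P 0)"
    and "gradient_flow dims (\<lambda>U. mean_sq_loss XS (XS *\<^sub>v \<theta>S) (end_to_end L U)) {1..L} P"
    and "((\<lambda>s. mean_sq_loss XS (XS *\<^sub>v \<theta>S) (end_to_end L (P s))) \<longlongrightarrow> 0) at_top"
    and "weights_tendsto L dims P (W 0)"
    and "end_to_end L (W 0) = \<theta>S"
    \<comment> \<open>hypothetical fine-tuning \<open>V\<close> of all layers\<close>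
    and "\<And>t. t \<ge> 0 \<Longrightarrow> is_weights L dims (V t)"
    and "\<forall>j\<in>{1..L}. V 0 j = W 0 j"
    and "gradient_flow dims (\<lambda>U. mean_sq_loss X y (end_to_end L U)) {1..L} V"
    and "((\<lambda>t. mean_sq_loss X y (end_to_end L (V t))) \<longlongrightarrow> 0) at_top"
    \<comment> \<open>fine-tuning \<open>W\<close> with the first \<open>k\<close> layers frozen\<close>
    and "1 \<le> k" and "k \<le> L"
    and "\<And>t. t \<ge> 0 \<Longrightarrow> is_weights L dims (W t)"
    and "\<And>t i. t \<ge> 0 \<Longrightarrow> 1 \<le> i \<Longrightarrow> i \<le> k \<Longrightarrow> W t i = W 0 i"
    and "gradient_flow dims (\<lambda>U. mean_sq_loss X y (end_to_end L U)) {k+1..L} W"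
  shows "\<forall>t\<ge>0. \<exists>c::real. \<forall>x\<in>carrier_vec d.
           scalar_prod (end_to_end L (W t)) x = c * scalar_prod x \<theta>S"
proof (intro allI impI)
  fix t :: real assume t: "t \<ge> 0"
  have dims: "dims 0 = d" "dims L = 1" using assms(9) by (auto simp: admissible_dims_def)
  note W0 = assms(24)[OF order_refl] and Wt = assms(24)[OF t]
  have L: "0 < L" using assms(8) by simp
  have "XS *\<^sub>v \<theta>S \<in> carrier_vec nS" using assms(5,11) by simp
  then have bal: "zero_balanced L (W 0)"
    using zero_balanced_limit[OF assms(12) dims assms(11) _ assms(14,13,16) W0] by blast
  define \<beta> where "\<beta> = end_to_end L (W t)"
  have \<beta>: "\<beta> \<in> carrier_vec d" unfolding \<beta>_def using end_to_end_carrier[OF Wt dims] .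
  have W1: "W 0 1 \<in> carrier_mat d (dims 1)" using is_weightsD[OF W0 L] dims by simp
  have q: "tail_vec L (W t) 2 \<in> carrier_vec (dims 1)"
    using tail_vec_carrier[OF Wt dims(2), of 1] L by (simp add: numeral_2_eq_2)
  \<comment> \<open>As \<open>1 \<le> k\<close>, layer 1 keeps its initial value, and time enters
    only through the tail.\<close>
  have \<beta>_eq: "\<beta> = W 0 1 *\<^sub>v tail_vec L (W t) 2"
    unfolding \<beta>_def end_to_end_eq_tail_vec using tail_vec_step[OF Wt dims(2) L] assms(25)[OF t, of 1] assms(22)
    by (simp add: numeral_2_eq_2)
  \<comment> \<open>The kernel lemma is applied to the weights at time 0, whose full product is
    \<open>\<theta>S\<close>; adjointness transfers the result to time \<open>t\<close>.\<close>
  have orth: "scalar_prod x \<beta> = 0" if x: "x \<in> carrier_vec d" and "scalar_prod x \<theta>S = 0" for x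
  proof -
    have "transpose_mat (W 0 1) *\<^sub>v x = 0\<^sub>v (dims 1)"
      using zero_balanced_kernel[OF W0 dims(2) bal, of 0 x] that assms(17) L dims
      by (simp add: end_to_end_eq_tail_vec)
    then show ?thesis
      using transpose_vec_mult_scalar[OF W1 q x] q by (simp add: \<beta>_eq)
  qed
  \<comment> \<open>The scalar is the coefficient of the projection of \<open>\<beta>\<close> onto
    \<open>\<theta>S\<close>. If \<open>\<theta>S\<close> is zero, every \<open>x\<close> is
    orthogonal to it and both sides are 0.\<close>
  have "scalar_prod \<beta> x = scalar_prod \<theta>S \<beta> / scalar_prod \<theta>S \<theta>S * scalar_prod x \<theta>S"
    if x: "x \<in> carrier_vec d" for x
  proof (cases "scalar_prod \<theta>S \<theta>S = 0")
    case True
    have "\<theta>S = 0\<^sub>v d"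
    proof (rule eq_vecI)
      have "(\<Sum>i = 0..<d. (vec_index \<theta>S i)\<^sup>2) = 0"
        using True assms(5) by (simp add: scalar_prod_def power2_eq_square)
      then show "vec_index \<theta>S i = vec_index (0\<^sub>v d) i" if "i < dim_vec (0\<^sub>v d)" for i
        using that by (simp add: sum_nonneg_eq_0_iff)
    qed (use assms(5) in simp)
    then show ?thesis using orth[OF x] x \<beta> True by (simp add: comm_scalar_prod[of \<beta> d x])
  next
    case False
    \<comment> \<open>Subtracting \<open>r\<close> times \<open>\<theta>S\<close> from
      \<open>x\<close> leaves a vector orthogonal to \<open>\<theta>S\<close>, hence to
      \<open>\<beta>\<close>.\<close>
    define r where "r = scalar_prod x \<theta>S / scalar_prod \<theta>S \<theta>S"
    have "scalar_prod (x - r \<cdot>\<^sub>v \<theta>S) \<theta>S = 0"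
      using x assms(5) False by (simp add: minus_scalar_prod_distrib[of _ d] r_def)
    then have "scalar_prod (x - r \<cdot>\<^sub>v \<theta>S) \<beta> = 0" using orth x assms(5) by simp
    then have "scalar_prod x \<beta> = r * scalar_prod \<theta>S \<beta>"
      using x assms(5) \<beta> by (simp add: minus_scalar_prod_distrib[of _ d])
    then show ?thesis using x \<beta> by (simp add: r_def comm_scalar_prod[of \<beta> d x])
  qed
  then show "\<exists>c::real. \<forall>x\<in>carrier_vec d. scalar_prod (end_to_end L (W t)) x = c * scalar_prod x \<theta>S"
    unfolding \<beta>_def by blast
qed

end
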